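(* Let $k>1$ be an even integer and $q>2$ any integer. Let $S_k(q)$ be the $\mathbb{Q}$-linear span of the numbers $\zeta(k,a/q)/\pi^k$ for $1\le a<q$, $\gcd(a,q)=1$, and let $\widehat{S}_k(q)$ be the $\mathbb{Q}$-linear span of $1$ together with these numbers. Then $S_k(q)=\widehat{S}_k(q)$.
   Context: For $0<x\le1$ and $\Re(s)>1$, the Hurwitz zeta function is $\zeta(s,x)=\sum_{n\ge0}(n+x)^{-s}$. *)

theory Defs
  imports "HOL-Analysis.Analysis"
begin

(* Only the range 0 < x <= 1, Re s > 1 is meant; outside it the value of the sum is not meaningful. *)
definition hurwitz_zeta :: "complex \<Rightarrow> real \<Rightarrow> complex" where
  "hurwitz_zeta s x = (\<Sum>n. (of_nat n + of_real x) powr (- s))"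

global_interpretation rat_complex: vector_space "\<lambda>(r::rat) (z::complex). of_rat r * z"
  by unfold_locales (simp_all add: algebra_simps of_rat_add of_rat_mult)

definition zeta_values :: "nat \<Rightarrow> nat \<Rightarrow> complex set" where
  "zeta_values k q =
     {hurwitz_zeta (of_nat k) (real a / real q) / of_real pi ^ k | a. 1 \<le> a \<and> a < q \<and> coprime a q}"

definition S_space :: "nat \<Rightarrow> nat \<Rightarrow> complex set" where
  "S_space k q = rat_complex.span (zeta_values k q)"

definition S_hat_space :: "nat \<Rightarrow> nat \<Rightarrow> complex set" where
  "S_hat_space k q = rat_complex.span (insert 1 (zeta_values k q))"

end

theory Submission
  imports Defs "HOL-Number_Theory.Totient"
begin

text \<open>
  Differentiating the reflection formula \<open>\<psi>(1 - x) - \<psi>(x) = \<pi> cot (\<pi> x)\<close> for the digamma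
  function \<open>k - 1\<close> times and evaluating at \<open>x = 1/2\<close>, where the cotangent vanishes, shows that
  \<open>\<zeta>(k,1/2)\<close> is a rational multiple of \<open>\<pi>\<^sup>k\<close> for even \<open>k\<close>. Sorting the terms of \<open>\<zeta>(k,1)\<close> by residue
  modulo \<open>d\<close> and the residues by their gcd with \<open>d\<close> gives
  \<open>d\<^sup>k \<zeta>(k,1) = \<Sum>\<^bsub>e|d\<^esub> Z(e)\<close>, where \<open>Z(e)\<close> is the sum of \<open>\<zeta>(k,a/e)\<close> over the \<open>a\<close> prime to \<open>e\<close>.
  Taking \<open>d = 2\<close> yields \<open>\<zeta>(k,1) = \<zeta>(k,1/2) / (2\<^sup>k - 1)\<close>, and induction on \<open>d\<close> shows that every
  \<open>Z(d)\<close> is a rational multiple of \<open>\<pi>\<^sup>k\<close>, nonzero because it is positive. So \<open>Z(q) / \<pi>\<^sup>k\<close>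
  is a nonzero rational number in the span.
\<close>

section \<open>Reflection formulas for polygamma functions\<close>

text \<open>Logarithmic differentiation of Euler's reflection formula: both derivatives carry the
  same nonzero factor \<open>pi / sin (pi * x)\<close>, which cancels.\<close>

lemma Digamma_reflection:
  fixes x :: real
  assumes "0 < x" "x < 1"
  shows "Digamma (1 - x) - Digamma x = pi * cot (pi * x)"
proof -
  have not_nonpos_Int: "y \<notin> \<int>\<^sub>\<le>\<^sub>0" if "0 < y" for y :: real
    using that by (auto elim!: nonpos_Ints_cases)
  have sin_pos: "sin (pi * y) > 0" if "0 < y" "y < 1" for y
    using that by (intro sin_gt_zero) auto
  \<comment> \<open>True for every real \<open>y\<close>: at integers both sides are 0 by the
    conventions for poles and for division by zero. So it can rewrite under a binder.\<close>
  have reflect: "Gamma y * Gamma (1 - y) = pi / sin (pi * y)" for y :: real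
  proof -
    have "complex_of_real (Gamma y * Gamma (1 - y)) = of_real (pi / sin (pi * y))"
      using Gamma_reflection_complex[of "of_real y"]
      by (simp flip: Gamma_complex_of_real sin_of_real)
    then show ?thesis by (simp only: of_real_eq_iff)
  qed
  have "((\<lambda>y. Gamma y * Gamma (1 - y)) has_real_derivative
      Gamma x * Gamma (1 - x) * (Digamma x - Digamma (1 - x))) (at x)"
    using assms by (auto intro!: derivative_eq_intros not_nonpos_Int simp: algebra_simps)
  moreover have "((\<lambda>y. pi / sin (pi * y)) has_real_derivative
      - (pi / sin (pi * x)) * (pi * cot (pi * x))) (at x)"
    using sin_pos[OF assms]
    by (auto intro!: derivative_eq_intros simp: cot_def field_simps power2_eq_square)
  ultimately have "Gamma x * Gamma (1 - x) * (Digamma x - Digamma (1 - x)) =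
      - (pi / sin (pi * x)) * (pi * cot (pi * x))"
    unfolding reflect by (rule DERIV_unique)
  then have "(pi / sin (pi * x)) * (Digamma x - Digamma (1 - x)) =
      (pi / sin (pi * x)) * (- (pi * cot (pi * x)))"
    unfolding reflect by simp
  then have "Digamma x - Digamma (1 - x) = - (pi * cot (pi * x))"
    using sin_pos[OF assms] by (subst (asm) mult_cancel_left) auto
  then show ?thesis by simp
qed

text \<open>Since \<open>cot' = -(1 + cot^2)\<close>, rational polynomials in \<open>cot\<close> are
  stable under differentiation; each step adds one factor \<open>pi\<close> from the inner argument,
  and a sign from \<open>1 - x\<close>.\<close>

lemma Polygamma_reflection:
  "\<exists>p. (\<forall>i. coeff p i \<in> \<rat>) \<and>
     (\<forall>x. 0 < x \<longrightarrow> x < 1 \<longrightarrow>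
        (- 1) ^ n * Polygamma n (1 - x) - Polygamma n x = pi ^ Suc n * poly p (cot (pi * x)))"
proof (induction n)
  case 0
  have "coeff [:0, 1 :: real:] i \<in> \<rat>" for i
    by (auto simp: coeff_pCons split: nat.split)
  then show ?case
    by (intro exI[of _ "[:0, 1:]"]) (auto simp: Digamma_reflection)
next
  case (Suc n)
  then obtain p where p: "\<And>i. coeff p i \<in> \<rat>"
    and reflect: "\<And>x. 0 < x \<Longrightarrow> x < 1 \<Longrightarrow>
      (- 1) ^ n * Polygamma n (1 - x) - Polygamma n x = pi ^ Suc n * poly p (cot (pi * x))"
    by blast
  define r where "r = - (pderiv p * [:1, 0, 1:])"
  have "coeff [:1, 0, 1 :: real:] i \<in> \<rat>" for i
    by (auto simp: coeff_pCons split: nat.split)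
  then have "coeff r i \<in> \<rat>" for i
    unfolding r_def by (simp only: coeff_minus coeff_mult coeff_pderiv)
      (intro Rats_minus_iff[THEN iffD2] Rats_sum Rats_mult Rats_of_nat p)
  moreover have "(- 1) ^ Suc n * Polygamma (Suc n) (1 - x) - Polygamma (Suc n) x =
      pi ^ Suc (Suc n) * poly r (cot (pi * x))" if x: "0 < x" "x < 1" for x
  proof -
    have not_nonpos_Int: "y \<notin> \<int>\<^sub>\<le>\<^sub>0" if "0 < y" for y :: real
      using that by (auto elim!: nonpos_Ints_cases)
    have sin_pos: "sin (pi * x) > 0"
      using x by (intro sin_gt_zero) auto
    have cot_sq: "inverse ((sin (pi * x))\<^sup>2) = 1 + (cot (pi * x))\<^sup>2"
      using sin_pos sin_cos_squared_add[of "pi * x"]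
      by (simp add: cot_def field_simps)
    have "((\<lambda>y. (- 1) ^ n * Polygamma n (1 - y) - Polygamma n y) has_real_derivative
        (- 1) ^ Suc n * Polygamma (Suc n) (1 - x) - Polygamma (Suc n) x) (at x)"
      using x by (auto intro!: derivative_eq_intros not_nonpos_Int)
    then have "((\<lambda>y. pi ^ Suc n * poly p (cot (pi * y))) has_real_derivative
        (- 1) ^ Suc n * Polygamma (Suc n) (1 - x) - Polygamma (Suc n) x) (at x)"
      by (rule has_field_derivative_transform_within_open[where S = "{0<..<1}"])
         (use x in \<open>auto simp: reflect\<close>)
    moreover have "((\<lambda>y. pi ^ Suc n * poly p (cot (pi * y))) has_real_derivative
        pi ^ Suc n * (poly (pderiv p) (cot (pi * x)) * (- inverse ((sin (pi * x))\<^sup>2) * pi))) (at x)"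
      by (intro DERIV_cmult DERIV_chain2[OF poly_DERIV] DERIV_chain2[OF DERIV_cot])
         (use sin_pos in \<open>auto intro!: derivative_eq_intros\<close>)
    ultimately have "(- 1) ^ Suc n * Polygamma (Suc n) (1 - x) - Polygamma (Suc n) x =
        pi ^ Suc n * (poly (pderiv p) (cot (pi * x)) * (- inverse ((sin (pi * x))\<^sup>2) * pi))"
      by (rule DERIV_unique)
    then show ?thesis
      unfolding cot_sq r_def by (simp add: algebra_simps power2_eq_square)
  qed
  ultimately show ?case by blast
qed

section \<open>Hurwitz zeta values as real series, and the value at 1/2\<close>

text \<open>Real-valued, so that positivity can be stated, and with summands in the form of the
  \<open>Polygamma\<close> series.\<close>

definition real_hurwitz :: "nat \<Rightarrow> real \<Rightarrow> real" where
  "real_hurwitz k x = (\<Sum>n. inverse ((x + real n) ^ k))"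

lemma sums_real_hurwitz:
  assumes "x > 0" "k \<ge> 2"
  shows "(\<lambda>n. inverse ((x + real n) ^ k)) sums real_hurwitz k x"
  unfolding real_hurwitz_def using assms
  by (intro summable_sums Polygamma_converges') auto

lemma real_hurwitz_pos:
  assumes "x > 0" "k \<ge> 2"
  shows "real_hurwitz k x > 0"
  unfolding real_hurwitz_def
  using assms sums_summable[OF sums_real_hurwitz[OF assms]]
  by (intro suminf_pos) (auto intro!: add_pos_nonneg)

lemma hurwitz_zeta_eq_real_hurwitz:
  assumes "x > 0" "k \<ge> 2"
  shows "hurwitz_zeta (of_nat k) x = of_real (real_hurwitz k x)"
proof -
  have "(of_nat n + complex_of_real x) powr (- of_nat k) = of_real (inverse ((x + real n) ^ k))" for n
  proof -
    have "of_nat n + complex_of_real x \<noteq> 0"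
      using assms by (simp add: complex_eq_iff add_nonneg_pos[THEN less_imp_neq, symmetric])
    then show ?thesis
      by (simp add: powr_minus powr_nat' add.commute)
  qed
  then show ?thesis
    unfolding hurwitz_zeta_def
    using sums_of_real[OF sums_real_hurwitz[OF assms], where 'a = complex] by (simp add: sums_iff)
qed

lemma real_hurwitz_half_Rats:
  assumes "k \<ge> 2" "even k"
  shows "real_hurwitz k (1 / 2) / pi ^ k \<in> \<rat>"
proof -
  obtain n where n: "k = Suc n" "odd n" "n > 0"
    using assms by (cases k) auto
  obtain p where p: "\<And>i. coeff p i \<in> \<rat>"
    and reflect: "\<And>x. 0 < x \<Longrightarrow> x < 1 \<Longrightarrow>
      (- 1) ^ n * Polygamma n (1 - x) - Polygamma n x = pi ^ Suc n * poly p (cot (pi * x))"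
    using Polygamma_reflection[of n] by blast
  have "Polygamma n (1/2 :: real) = fact n * real_hurwitz k (1/2)"
    using n by (simp add: Polygamma_def real_hurwitz_def)
  moreover have "poly p (cot (pi * (1/2))) = coeff p 0"
    by (simp add: cot_def poly_0_coeff_0)
  \<comment> \<open>At 1/2 both arguments coincide; as \<open>n\<close> is odd, the two terms add up
    instead of cancelling.\<close>
  ultimately have "- 2 * (fact n * real_hurwitz k (1/2)) = pi ^ k * coeff p 0"
    using reflect[of "1 / 2"] n by simp
  then have "real_hurwitz k (1/2) / pi ^ k = - coeff p 0 / (2 * of_nat (fact n))"
    by (simp add: field_simps)
  also have "\<dots> \<in> \<rat>"
    by (intro Rats_divide Rats_minus_iff[THEN iffD2] Rats_mult Rats_of_nat p) simp
  finally show ?thesis .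
qed

section \<open>Sorting by residues and by gcd; rationality\<close>

lemma sum_real_hurwitz_residues:
  assumes "k \<ge> 2" "d > 0"
  shows "(\<Sum>a\<in>{0<..d}. real_hurwitz k (real a / real d)) = real d ^ k * real_hurwitz k 1"
proof -
  define f where "f n = inverse ((1 + real n) ^ k)" for n
  have group: "(\<lambda>n. sum f {n * d..<n * d + d}) sums real_hurwitz k 1"
    using assms unfolding f_def by (intro sums_group sums_real_hurwitz) auto
  have "(\<Sum>a\<in>{0<..d}. inverse ((real a / real d + real n) ^ k)) =
      real d ^ k * sum f {n * d..<n * d + d}" for n
  proof -
    \<comment> \<open>\<open>f m\<close> belongs to the integer \<open>m + 1\<close>, hence the
      shift by one; \<open>a > 0\<close> keeps the natural subtraction exact.\<close>
    have "inverse ((real a / real d + real n) ^ k) = real d ^ k * f (n * d + a - 1)"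
      if "a \<in> {0<..d}" for a
    proof -
      have "1 + real (n * d + a - 1) = real d * (real a / real d + real n)"
        using that assms by (simp add: of_nat_diff field_simps)
      then show ?thesis
        unfolding f_def using assms by (simp add: power_mult_distrib)
    qed
    then have "(\<Sum>a\<in>{0<..d}. inverse ((real a / real d + real n) ^ k)) =
        real d ^ k * (\<Sum>a\<in>{0<..d}. f (n * d + a - 1))"
      by (simp add: sum_distrib_left)
    also have "(\<Sum>a\<in>{0<..d}. f (n * d + a - 1)) = sum f {n * d..<n * d + d}"
      by (rule sum.reindex_bij_witness[of _ "\<lambda>m. m + 1 - n * d" "\<lambda>a. n * d + a - 1"]) auto
    finally show ?thesis .
  qed
  then have "(\<lambda>n. real d ^ k * sum f {n * d..<n * d + d}) sums
      (\<Sum>a\<in>{0<..d}. real_hurwitz k (real a / real d))"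
    using sums_sum[of "{0<..d}" "\<lambda>a n. inverse ((real a / real d + real n) ^ k)"
      "\<lambda>a. real_hurwitz k (real a / real d)"] assms
    by (simp add: sums_real_hurwitz)
  with sums_mult[OF group, of "real d ^ k"] show ?thesis
    by (blast dest: sums_unique2)
qed

text \<open>Each fraction \<open>a / d\<close> is reduced to lowest terms; its denominator is
  \<open>d div gcd a d\<close>.\<close>

lemma sum_totatives_divisors:
  fixes g :: "real \<Rightarrow> real"
  assumes "d > 0"
  shows "(\<Sum>a\<in>{0<..d}. g (real a / real d)) =
    (\<Sum>e | e dvd d. \<Sum>a\<in>totatives e. g (real a / real e))"
proof -
  have inner: "(\<Sum>a | a \<in> {0<..d} \<and> gcd a d = c. g (real a / real d)) =
      (\<Sum>a\<in>totatives (d div c). g (real a / real (d div c)))" if "c dvd d" for c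
  proof -
    have "c > 0" using that assms by (auto intro: Nat.gr0I)
    then show ?thesis
      using that assms
      by (subst sum.reindex_bij_betw[OF bij_betw_totatives_gcd_eq[OF that assms], symmetric])
         (auto simp: real_of_nat_div field_simps)
  qed
  have "(\<Sum>a\<in>{0<..d}. g (real a / real d)) =
      (\<Sum>c | c dvd d. \<Sum>a | a \<in> {0<..d} \<and> gcd a d = c. g (real a / real d))"
    using assms by (intro sum.group[symmetric]) auto
  also have "\<dots> = (\<Sum>c | c dvd d. \<Sum>a\<in>totatives (d div c). g (real a / real (d div c)))"
    by (rule sum.cong[OF refl], rule inner) simp
  \<comment> \<open>Passing to the complementary divisor is an involution on the divisors of
    \<open>d\<close>.\<close>
  also have "\<dots> = (\<Sum>e | e dvd d. \<Sum>a\<in>totatives e. g (real a / real e))"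
    by (rule sum.reindex_bij_witness[where i = "(div) d" and j = "(div) d"]) (use assms in auto)
  finally show ?thesis .
qed

lemma real_hurwitz_1_Rats:
  assumes "k \<ge> 2" "even k"
  shows "real_hurwitz k 1 / pi ^ k \<in> \<rat>"
proof -
  have "{0<..2::nat} = {1, 2}" by auto
  then have "real_hurwitz k (1 / 2) = (2 ^ k - 1) * real_hurwitz k 1"
    using sum_real_hurwitz_residues[of k 2] assms by (simp add: algebra_simps)
  moreover have "(1 :: real) < 2 ^ k"
    using assms by (intro one_less_power) auto
  ultimately have "real_hurwitz k 1 / pi ^ k = (real_hurwitz k (1 / 2) / pi ^ k) / (2 ^ k - 1)"
    by simp
  also have "\<dots> \<in> \<rat>"
    using assms by (intro Rats_divide real_hurwitz_half_Rats Rats_diff Rats_power) auto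
  finally show ?thesis .
qed

lemma sum_totatives_real_hurwitz_Rats:
  assumes "k \<ge> 2" "even k" "d > 0"
  shows "(\<Sum>a\<in>totatives d. real_hurwitz k (real a / real d)) / pi ^ k \<in> \<rat>"
  using \<open>d > 0\<close>
proof (induction d rule: less_induct)
  case (less d)
  define Z where "Z e = (\<Sum>a\<in>totatives e. real_hurwitz k (real a / real e))" for e
  \<comment> \<open>Splitting off \<open>d\<close> isolates \<open>Z d\<close>; the induction
    hypothesis covers the proper divisors.\<close>
  have "{e. e dvd d} = insert d {e. e dvd d \<and> e < d}"
    using less.prems by (auto dest: dvd_imp_le)
  then have "Z d + (\<Sum>e | e dvd d \<and> e < d. Z e) = real d ^ k * real_hurwitz k 1"
    using sum_totatives_divisors[of d "real_hurwitz k"] sum_real_hurwitz_residues[of k d] assms less.prems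
    by (simp add: Z_def)
  then have "Z d / pi ^ k =
      real d ^ k * (real_hurwitz k 1 / pi ^ k) - (\<Sum>e | e dvd d \<and> e < d. Z e / pi ^ k)"
    by (simp add: field_simps flip: sum_divide_distrib)
  also have "\<dots> \<in> \<rat>"
    using assms less.prems unfolding Z_def
    by (intro Rats_diff Rats_mult Rats_power real_hurwitz_1_Rats Rats_sum less.IH)
       (auto intro: Nat.gr0I)
  finally show ?case by (simp add: Z_def)
qed

section \<open>A nonzero rational number in the span\<close>

lemma one_mem_S_space:
  assumes "k > 1" and "even k" and "q > 2"
  shows "1 \<in> S_space k q"
proof -
  let ?Z = "\<Sum>a\<in>totatives q. real_hurwitz k (real a / real q)"
  have k: "k \<ge> 2" using assms by simp
  obtain r :: rat where r: "?Z / pi ^ k = of_rat r"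
    using sum_totatives_real_hurwitz_Rats[OF k \<open>even k\<close>, of q] assms by (auto elim!: Rats_cases)
  \<comment> \<open>The sum is thus nonempty, so it is strictly positive and \<open>r\<close> can be
    inverted.\<close>
  have "1 \<in> totatives q"
    using assms by (simp add: in_totatives_iff)
  then have "?Z > 0"
    using k assms by (intro sum_pos real_hurwitz_pos) (auto simp: in_totatives_iff)
  then have "r \<noteq> 0"
    using r by auto
  have "complex_of_real (real_hurwitz k (real a / real q)) / of_real pi ^ k \<in> zeta_values k q"
    if "a \<in> totatives q" for a
  proof -
    \<comment> \<open>\<open>totatives q\<close> only gives \<open>a \<le> q\<close>, while
      \<open>zeta_values\<close> asks for \<open>a < q\<close>; \<open>q\<close> is not prime to
      itself because \<open>q > 2\<close>.\<close>
    have "a \<noteq> q"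
      using that assms by (auto simp: in_totatives_iff)
    then show ?thesis
      using that assms k unfolding zeta_values_def
      by (auto simp: in_totatives_iff hurwitz_zeta_eq_real_hurwitz intro!: exI[of _ a])
  qed
  then have "(\<Sum>a\<in>totatives q. complex_of_real (real_hurwitz k (real a / real q)) / of_real pi ^ k)
      \<in> S_space k q"
    unfolding S_space_def by (intro rat_complex.span_sum rat_complex.span_base)
  also have "(\<Sum>a\<in>totatives q. complex_of_real (real_hurwitz k (real a / real q)) / of_real pi ^ k) =
      of_real (?Z / pi ^ k)"
    by (simp add: sum_divide_distrib)
  also have "\<dots> = of_rat r"
    unfolding r by (cases r) (simp add: of_rat_rat)
  finally have "of_rat (1 / r) * of_rat r \<in> S_space k q"
    unfolding S_space_def by (rule rat_complex.span_scale)
  then show ?thesis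
    using \<open>r \<noteq> 0\<close> by (simp flip: of_rat_mult)
qed

theorem theorem5p3:
  fixes k q :: nat
  assumes "k > 1" and "even k" and "q > 2"
  shows "S_space k q = S_hat_space k q"
  using one_mem_S_space[OF assms] unfolding S_space_def S_hat_space_def
  by (simp add: rat_complex.span_redundant)

end
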